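(* Consider the parallel randomized coordinate descent method (Algorithm 1): given an $\alpha$-proper distribution $P$ and $y^{(0)}\in\mathcal{B}$, at each iteration $k$ draw $C_{i_k}\sim P$ independently of the past; for every $r\in C_{i_k}$ set $y_r^{(k+1)}=\Pi_{\mathcal{B}_r,\theta^P_r}\big(y_r^{(k)}-(\theta^P_r)^{-1}\odot\nabla_rg(y^{(k)})\big)$, and set $y_r^{(k+1)}=y_r^{(k)}$ for $r\notin C_{i_k}$. Let $g^*=\min_{y\in\mathcal{B}}g(y)$. Then for all $k\ge0$, $$\mathbb{E}\Big[g(y^{(k)})-g^*+\tfrac12d^2_{\theta^P}(y^{(k)},\Xi)\Big]\le\Big[1-\frac{4\alpha}{N\|\theta^P\|_{1,\infty}+2}\Big]^k\Big[g(y^{(0)})-g^*+\tfrac12d^2_{\theta^P}(y^{(0)},\Xi)\Big].$$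
   Context: Let $N,R$ be positive integers; $F_r:2^{[N]}\to\mathbb{R}$ ($r\in[R]$) are submodular with $F_r(\emptyset)=0$, base polytopes $\mathcal{B}_r=\{u\in\mathbb{R}^N:\sum_{i\in S}u_i\le F_r(S)\ \forall S,\ \sum_iu_i=F_r([N])\}$, Lovász extensions $f_r(x)=\max_{u\in\mathcal{B}_r}\langle u,x\rangle$; $\mathcal{B}=\mathcal{B}_1\times\cdots\times\mathcal{B}_R$; $A:(\mathbb{R}^N)^R\to\mathbb{R}^N$, $Ay=\sum_ry_r$; $g(y)=\frac12\|Ay\|_2^2$, with block gradient $\nabla_rg(y)=Ay$. Element $i$ is incident to $F_r$ if $F_r(S\cup\{i\})\ne F_r(S)$ for some $S\subseteq[N]\setminus\{i\}$; $S_r$ is the set of elements incident to $F_r$ (points of $\mathcal{B}_r$ vanish outside $S_r$); assume every $i$ lies in some $S_r$. $\mu^C_i=|\{r\in C:i\in S_r\}|$ for $C\subseteq[R]$. $P$ on subsets of $[R]$ is $\alpha$-proper ($\alpha\in(0,1)$) if $\mathbb{P}_{C\sim P}(r\in C)=\alpha$ for all $r$; $\theta^P_r=\mathbb{E}_{C\sim P}[\mu^C\mid r\in C]$ (only its coordinates in $S_r$, which are $\ge1$, matter). $\odot$ and $(\cdot)^{-1}$ act element-wise. $\|z\|_{2,w}=\sqrt{\sum_iw_iz_i^2}$, $\Pi_{\Omega,w}(u)=\arg\min_{z\in\Omega}\|z-u\|_{2,w}$; $\|y\|_{2,\theta}=\sqrt{\sum_r\|y_r\|^2_{2,\theta_r}}$;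 $\|\theta\|_{1,\infty}=\sum_i\max_{r:i\in S_r}\theta_{r,i}$; $d_\theta(y,\mathcal{K})=\min_{z\in\mathcal{K}}\|y-z\|_{2,\theta}$. $x^*$ is the unique minimizer of $\sum_rf_r(x)+\frac12\|x\|_2^2$ and $\Xi=\{\xi\in\mathcal{B}:A\xi=-x^*\}$ (the set of minimizers of $g$ on $\mathcal{B}$). *)

theory Defs
  imports "HOL-Probability.Probability"
begin

(* Ground set [N] is a finite type 'n (N = CARD('n)); index set [R] is a finite type 'r.
   Vectors in R^N are functions 'n => real; block vectors in (R^N)^R are 'r => 'n => real. *)

definition submodular :: "('n set \<Rightarrow> real) \<Rightarrow> bool" where
  "submodular F \<longleftrightarrow> (\<forall>S T. F (S \<union> T) + F (S \<inter> T) \<le> F S + F T)"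

definition base_polytope :: "('n::finite set \<Rightarrow> real) \<Rightarrow> ('n \<Rightarrow> real) set" where
  "base_polytope F = {u. (\<forall>S. (\<Sum>i\<in>S. u i) \<le> F S) \<and> (\<Sum>i\<in>UNIV. u i) = F UNIV}"

definition lovasz :: "('n::finite set \<Rightarrow> real) \<Rightarrow> ('n \<Rightarrow> real) \<Rightarrow> real" where
  "lovasz F x = Sup ((\<lambda>u. \<Sum>i\<in>UNIV. u i * x i) ` base_polytope F)"

definition incident :: "('n set \<Rightarrow> real) \<Rightarrow> 'n \<Rightarrow> bool" where
  "incident F i \<longleftrightarrow> (\<exists>S. i \<notin> S \<and> F (insert i S) \<noteq> F S)"

definition supp_set :: "('n set \<Rightarrow> real) \<Rightarrow> 'n set" where
  "supp_set F = {i. incident F i}"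

definition mu :: "('r \<Rightarrow> 'n set) \<Rightarrow> 'r set \<Rightarrow> 'n \<Rightarrow> nat" where
  "mu S C i = card {r\<in>C. i \<in> S r}"

definition alpha_proper :: "'r set pmf \<Rightarrow> real \<Rightarrow> bool" where
  "alpha_proper P \<alpha> \<longleftrightarrow> 0 < \<alpha> \<and> \<alpha> < 1 \<and> (\<forall>r. measure_pmf.prob P {C. r \<in> C} = \<alpha>)"

(* theta^P_r = E_{C~P}[mu^C | r in C] = E[mu^C 1_{r in C}] / P(r in C) *)
definition thetaP :: "('r \<Rightarrow> 'n set) \<Rightarrow> 'r set pmf \<Rightarrow> 'r \<Rightarrow> 'n \<Rightarrow> real" where
  "thetaP S P r i =
     measure_pmf.expectation P (\<lambda>C. if r \<in> C then real (mu S C i) else 0)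
       / measure_pmf.prob P {C. r \<in> C}"

definition thetaF :: "('r \<Rightarrow> 'n set \<Rightarrow> real) \<Rightarrow> 'r set pmf \<Rightarrow> 'r \<Rightarrow> 'n \<Rightarrow> real" where
  "thetaF F P = thetaP (\<lambda>r. supp_set (F r)) P"

definition wnorm :: "('n::finite \<Rightarrow> real) \<Rightarrow> ('n \<Rightarrow> real) \<Rightarrow> real" where
  "wnorm w z = sqrt (\<Sum>i\<in>UNIV. w i * (z i)\<^sup>2)"

definition wproj :: "('n::finite \<Rightarrow> real) set \<Rightarrow> ('n \<Rightarrow> real) \<Rightarrow> ('n \<Rightarrow> real) \<Rightarrow> ('n \<Rightarrow> real)" where
  "wproj \<Omega> w u = (SOME z. z \<in> \<Omega> \<and> (\<forall>z'\<in>\<Omega>. wnorm w (z - u) \<le> wnorm w (z' - u)))"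

definition blocknorm :: "('r::finite \<Rightarrow> 'n::finite \<Rightarrow> real) \<Rightarrow> ('r \<Rightarrow> 'n \<Rightarrow> real) \<Rightarrow> real" where
  "blocknorm \<theta> y = sqrt (\<Sum>r\<in>UNIV. (wnorm (\<theta> r) (y r))\<^sup>2)"

definition norm1inf :: "('r::finite \<Rightarrow> 'n set) \<Rightarrow> ('r \<Rightarrow> 'n::finite \<Rightarrow> real) \<Rightarrow> real" where
  "norm1inf S \<theta> = (\<Sum>i\<in>UNIV. Max {\<theta> r i | r. i \<in> S r})"

definition dist_theta :: "('r::finite \<Rightarrow> 'n::finite \<Rightarrow> real) \<Rightarrow> ('r \<Rightarrow> 'n \<Rightarrow> real) \<Rightarrow> ('r \<Rightarrow> 'n \<Rightarrow> real) set \<Rightarrow> real" where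
  "dist_theta \<theta> y K = Inf ((\<lambda>z. blocknorm \<theta> (y - z)) ` K)"

definition Aop :: "('r::finite \<Rightarrow> 'n \<Rightarrow> real) \<Rightarrow> 'n \<Rightarrow> real" where
  "Aop y = (\<lambda>i. \<Sum>r\<in>UNIV. y r i)"

definition gfun :: "('r::finite \<Rightarrow> 'n::finite \<Rightarrow> real) \<Rightarrow> real" where
  "gfun y = 1/2 * (\<Sum>i\<in>UNIV. (Aop y i)\<^sup>2)"

definition Bprod :: "('r \<Rightarrow> 'n::finite set \<Rightarrow> real) \<Rightarrow> ('r \<Rightarrow> 'n \<Rightarrow> real) set" where
  "Bprod F = {y. \<forall>r. y r \<in> base_polytope (F r)}"

definition gstar :: "('r::finite \<Rightarrow> 'n::finite set \<Rightarrow> real) \<Rightarrow> real" where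
  "gstar F = Inf (gfun ` Bprod F)"

definition xstar :: "('r::finite \<Rightarrow> 'n::finite set \<Rightarrow> real) \<Rightarrow> 'n \<Rightarrow> real" where
  "xstar F = (THE x. \<forall>x'. (\<Sum>r\<in>UNIV. lovasz (F r) x) + 1/2 * (\<Sum>i\<in>UNIV. (x i)\<^sup>2)
                        \<le> (\<Sum>r\<in>UNIV. lovasz (F r) x') + 1/2 * (\<Sum>i\<in>UNIV. (x' i)\<^sup>2))"

definition Xi :: "('r::finite \<Rightarrow> 'n::finite set \<Rightarrow> real) \<Rightarrow> ('r \<Rightarrow> 'n \<Rightarrow> real) set" where
  "Xi F = {\<xi> \<in> Bprod F. Aop \<xi> = - xstar F}"

(* One iteration of Algorithm 1 for the drawn set C; grad_r g(y) = A y *)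
definition pcd_step :: "('r::finite \<Rightarrow> 'n::finite set \<Rightarrow> real) \<Rightarrow> ('r \<Rightarrow> 'n \<Rightarrow> real)
     \<Rightarrow> 'r set \<Rightarrow> ('r \<Rightarrow> 'n \<Rightarrow> real) \<Rightarrow> ('r \<Rightarrow> 'n \<Rightarrow> real)" where
  "pcd_step F \<theta> C y = (\<lambda>r. if r \<in> C
      then wproj (base_polytope (F r)) (\<theta> r) (y r - (\<lambda>i. Aop y i / \<theta> r i))
      else y r)"

primrec pcd_iter :: "('r::finite \<Rightarrow> 'n::finite set \<Rightarrow> real) \<Rightarrow> ('r \<Rightarrow> 'n \<Rightarrow> real)
     \<Rightarrow> 'r set pmf \<Rightarrow> ('r \<Rightarrow> 'n \<Rightarrow> real) \<Rightarrow> nat \<Rightarrow> ('r \<Rightarrow> 'n \<Rightarrow> real) pmf" where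
  "pcd_iter F \<theta> P y0 0 = return_pmf y0"
| "pcd_iter F \<theta> P y0 (Suc k) =
     bind_pmf (pcd_iter F \<theta> P y0 k) (\<lambda>y. map_pmf (\<lambda>C. pcd_step F \<theta> C y) P)"

end

theory Submission
  imports Defs
begin

text \<open>
  With \<open>\<xi>\<close> a minimizer of \<open>g\<close> on \<open>B\<close>, first-order optimality gives \<open>x* = - A \<xi>\<close>, so
  \<open>\<Xi>\<close> is the fibre of \<open>A\<close> over \<open>A \<xi>\<close> in \<open>B\<close>.

  The geometric core is the bound of \<open>d\<^sub>\<theta>(y, \<Xi>)\<^sup>2\<close> by \<open>M / 2 * \<parallel>A y - A \<xi>\<parallel>\<^sup>2\<close> with
  \<open>M = N \<parallel>\<theta>\<parallel>\<^sub>1\<^sub>,\<^sub>\<infinity>\<close>. Let \<open>z\<close> be the Euclidean closest point to \<open>y\<close> in the fibre, and draw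
  an arc \<open>i \<rightarrow> j\<close> if in some block mass of \<open>z\<close> can be moved from \<open>i\<close> to \<open>j\<close> so that both
  coordinates approach \<open>y\<close>. A cycle would permit moving closer to \<open>y\<close> inside the fibre, so
  the arcs are acyclic. If no arc leaves \<open>U\<close>, uncrossing tight sets gives \<open>z\<^sub>r(U) \<le> y\<^sub>r(U)\<close>
  in every block. Applied to the set \<open>U\<close> of points reachable from \<open>i\<close>, with and without
  \<open>i\<close>, this bounds the total excess of \<open>z\<close> over \<open>y\<close> at \<open>i\<close> by \<open>(A y - A z)(U)\<close>, which is at
  most \<open>\<parallel>A y - A z\<parallel>\<^sub>1 / 2\<close>; the deficit is bounded in the same way by the points that reach \<open>i\<close>.

  Call \<open>g y - g* + d\<^sub>\<theta>(y, \<Xi>)\<^sup>2 / 2\<close> the potential of \<open>y\<close>.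
  For one iteration, put \<open>a = g y - g*\<close> and \<open>b = \<parallel>A y - A \<xi>\<parallel>\<^sup>2 / 2 \<le> a\<close>. The three-point
  inequality of the projections lowers the expected potential by at least \<open>\<alpha> (a + b)\<close>, and
  the geometric bound gives potential \<open>\<le> a + M b / 2\<close>. The rate follows from
  \<open>(a - b) (M - 2) \<ge> 0\<close>; since \<open>M \<ge> N\<^sup>2\<close>, only \<open>N = 1\<close> needs a separate argument, and there
  \<open>B\<close> is a single point.
\<close>

section \<open>Base polytopes\<close>

text \<open>Tychonoff's theorem for total functions, applied once to the coordinates of a vector and
  once to the blocks of a block vector.\<close>

lemma compact_Pi_UNIV:
  fixes S :: "'a \<Rightarrow> 'b::topological_space set"
  assumes "\<And>i. compact (S i)"
  shows "compact {u. \<forall>i. u i \<in> S i}"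
proof -
  have "compactin (product_topology (\<lambda>_. euclidean) UNIV) (PiE UNIV S)"
    using assms by (subst compactin_PiE) auto
  moreover have "PiE UNIV S = {u. \<forall>i. u i \<in> S i}"
    by (auto simp: PiE_UNIV_domain)
  ultimately show ?thesis
    by (simp add: euclidean_product_topology)
qed

lemma base_polytopeD:
  assumes "u \<in> base_polytope F"
  shows "sum u S \<le> F S" and "sum u UNIV = F UNIV"
  using assms by (auto simp: base_polytope_def)

text \<open>The lower bound combines the constraint on the complement of \<open>i\<close> with the
  fixed total. The resulting box makes the polytope compact.\<close>

lemma base_polytope_bounds:
  assumes "u \<in> base_polytope F"
  shows "u i \<le> F {i}" and "F UNIV - F (UNIV - {i}) \<le> u i"
proof -
  show "u i \<le> F {i}" using base_polytopeD(1)[OF assms, of "{i}"] by simp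
  have "sum u UNIV = u i + sum u (UNIV - {i})"
    by (rule sum.remove) auto
  then show "F UNIV - F (UNIV - {i}) \<le> u i"
    using base_polytopeD[OF assms] by (smt (verit))
qed

text \<open>All marginal values of \<open>i\<close> are 0, so the upper and the lower bound on
  \<open>u i\<close> collapse to 0.\<close>

lemma base_polytope_vanish:
  assumes "F {} = 0" "u \<in> base_polytope F" "i \<notin> supp_set F"
  shows "u i = 0"
proof -
  have *: "F (insert i S) = F S" if "i \<notin> S" for S
    using assms(3) that by (auto simp: supp_set_def incident_def)
  have "F {i} = 0" using *[of "{}"] assms(1) by simp
  moreover have "F UNIV = F (UNIV - {i})" using *[of "UNIV - {i}"] by (simp add: insert_UNIV)
  ultimately show ?thesis using base_polytope_bounds[OF assms(2), of i] by simp
qed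

lemma base_polytope_convex:
  assumes "u \<in> base_polytope F" "v \<in> base_polytope F" "0 \<le> t" "t \<le> 1"
  shows "(\<lambda>i. u i + t * (v i - u i)) \<in> base_polytope F"
proof -
  have eq: "(\<Sum>i\<in>S. u i + t * (v i - u i)) = (1 - t) * sum u S + t * sum v S" for S
    by (simp add: sum.distrib sum_distrib_left sum_subtractf algebra_simps)
  have "(1 - t) * sum u S + t * sum v S \<le> (1 - t) * F S + t * F S" for S
    using base_polytopeD(1)[OF assms(1), of S] base_polytopeD(1)[OF assms(2), of S] assms(3,4)
    by (intro add_mono mult_left_mono) auto
  then have "(1 - t) * sum u S + t * sum v S \<le> F S" for S
    by (simp add: left_diff_distrib)
  moreover have "(1 - t) * sum u UNIV + t * sum v UNIV = F UNIV"
    using base_polytopeD(2)[OF assms(1)] base_polytopeD(2)[OF assms(2)]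
    by (simp add: left_diff_distrib)
  ultimately show ?thesis
    unfolding base_polytope_def mem_Collect_eq eq by blast
qed

lemma compact_base_polytope: "compact (base_polytope F)"
proof -
  let ?K = "{u. \<forall>i. u i \<in> {F UNIV - F (UNIV - {i})..F {i}}}"
  have "closed (base_polytope F)"
    unfolding base_polytope_def
    by (intro closed_Collect_conj closed_Collect_all closed_Collect_le closed_Collect_eq
        continuous_intros continuous_on_product_coordinates)
  then have "compact (?K \<inter> base_polytope F)"
    by (intro compact_Int_closed compact_Pi_UNIV compact_Icc)
  moreover have "base_polytope F \<subseteq> ?K"
    using base_polytope_bounds by fastforce
  ultimately show ?thesis
    by (simp only: Int_absorb1)
qed

lemma compact_Bprod: "compact (Bprod F)"
  unfolding Bprod_def by (rule compact_Pi_UNIV) (rule compact_base_polytope)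

lemma Bprod_convex:
  assumes "y \<in> Bprod F" "z \<in> Bprod F" "0 \<le> t" "t \<le> 1"
  shows "(\<lambda>r i. y r i + t * (z r i - y r i)) \<in> Bprod F"
  using assms by (auto simp: Bprod_def intro: base_polytope_convex)

section \<open>Continuity of the sum map and compactness of its fibres\<close>

lemma continuous_on_coordinate: "continuous_on S (\<lambda>u. u i)"
  by (rule continuous_on_subset[OF continuous_on_product_coordinates]) simp

lemma continuous_on_block_coordinate: "continuous_on S (\<lambda>y. y r i)"
  by (rule continuous_on_product_then_coordinatewise) (rule continuous_on_coordinate)

lemma continuous_on_Aop: "continuous_on S (\<lambda>y. Aop y i)"
  unfolding Aop_def by (intro continuous_intros continuous_on_block_coordinate)

lemma continuous_on_gfun: "continuous_on S gfun"
  unfolding gfun_def by (intro continuous_intros continuous_on_Aop)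

lemma compact_Bprod_fibre: "compact {z \<in> Bprod F. Aop z = b}"
proof -
  have "closed {z. \<forall>i. Aop z i = b i}"
    by (intro closed_Collect_all closed_Collect_eq continuous_intros continuous_on_Aop)
  then have "compact (Bprod F \<inter> {z. \<forall>i. Aop z i = b i})"
    by (rule compact_Int_closed[OF compact_Bprod])
  then show ?thesis by (simp add: Int_def fun_eq_iff)
qed

text \<open>Dividing by \<open>t\<close> and letting \<open>t\<close> tend to 0 isolates the linear
  term. This turns minimality along a segment into a first-order condition: for \<open>gfun\<close>,
  for closest points in a fibre and for projections.\<close>

lemma first_order_nonneg:
  fixes a b :: real
  assumes "\<And>t. 0 < t \<Longrightarrow> t \<le> 1 \<Longrightarrow> 0 \<le> t * a + t\<^sup>2 * b"
  shows "0 \<le> a"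
proof (rule ccontr)
  assume "\<not> 0 \<le> a"
  \<comment> \<open>This choice keeps \<open>t * b\<close> at most \<open>- a / 2\<close>, so the
    linear term wins; the \<open>+ 1\<close> avoids a zero denominator.\<close>
  define t where "t = min 1 (- a / (2 * (\<bar>b\<bar> + 1)))"
  have t: "0 < t" "t \<le> 1" using \<open>\<not> 0 \<le> a\<close> by (auto simp: t_def divide_neg_pos)
  have "t \<le> - a / (2 * (\<bar>b\<bar> + 1))" by (simp add: t_def)
  then have "t * (2 * (\<bar>b\<bar> + 1)) \<le> - a" by (subst (asm) pos_le_divide_eq) auto
  moreover have "t * b \<le> t * (\<bar>b\<bar> + 1)" using t by (intro mult_left_mono) auto
  ultimately have "a + t * b < 0" using \<open>\<not> 0 \<le> a\<close> by linarith
  then have "t * (a + t * b) < 0" using t(1) by (rule mult_pos_neg[rotated])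
  then show False using assms[OF t] by (simp add: algebra_simps power2_eq_square)
qed

section \<open>The dual pair\<close>

lemma Aop_segment:
  "Aop (\<lambda>r i. y r i + t * (z r i - y r i)) i = Aop y i + t * (Aop z i - Aop y i)"
  by (simp add: Aop_def sum.distrib sum_subtractf flip: sum_distrib_left)

text \<open>Only images under \<open>Aop\<close> enter \<open>gfun\<close>, so \<open>z\<close>
  itself need not lie on a line through \<open>y\<close>; \<open>t = 1\<close> gives the exact
  expansion between any two points.\<close>

lemma gfun_expand:
  assumes "\<And>i. Aop z i = Aop y i + t * h i"
  shows "gfun z = gfun y + t * (\<Sum>i\<in>UNIV. Aop y i * h i) + t\<^sup>2 * (1/2 * (\<Sum>i\<in>UNIV. (h i)\<^sup>2))"
proof -
  have "(Aop z i)\<^sup>2 = (Aop y i)\<^sup>2 + 2 * t * (Aop y i * h i) + t\<^sup>2 * (h i)\<^sup>2" for i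
    unfolding assms by (simp add: power2_eq_square algebra_simps)
  then show ?thesis
    unfolding gfun_def by (simp only: sum.distrib sum_distrib_left[symmetric]) (simp add: algebra_simps)
qed

lemma gfun_minimizer_exists:
  assumes "Bprod F \<noteq> {}"
  obtains \<xi> where "\<xi> \<in> Bprod F" "\<And>y. y \<in> Bprod F \<Longrightarrow> gfun \<xi> \<le> gfun y"
  using continuous_attains_inf[OF compact_Bprod assms continuous_on_gfun] by blast

lemma gfun_minimizer_variational:
  assumes "\<xi> \<in> Bprod F" "\<And>y. y \<in> Bprod F \<Longrightarrow> gfun \<xi> \<le> gfun y" "y \<in> Bprod F"
  shows "0 \<le> (\<Sum>i\<in>UNIV. Aop \<xi> i * (Aop y i - Aop \<xi> i))"
proof (rule first_order_nonneg)
  fix t :: real assume t: "0 < t" "t \<le> 1"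
  have "gfun \<xi> \<le> gfun (\<lambda>r i. \<xi> r i + t * (y r i - \<xi> r i))"
    using t by (intro assms(2) Bprod_convex assms) auto
  then show "0 \<le> t * (\<Sum>i\<in>UNIV. Aop \<xi> i * (Aop y i - Aop \<xi> i))
      + t\<^sup>2 * (1/2 * (\<Sum>i\<in>UNIV. (Aop y i - Aop \<xi> i)\<^sup>2))"
    by (simp add: gfun_expand[OF Aop_segment])
qed

text \<open>The linear term of the expansion at the minimizer is nonnegative, which leaves the
  quadratic one.\<close>

lemma gfun_minimizer_gap:
  assumes "\<xi> \<in> Bprod F" "\<And>y. y \<in> Bprod F \<Longrightarrow> gfun \<xi> \<le> gfun y" "y \<in> Bprod F"
  shows "1/2 * (\<Sum>i\<in>UNIV. (Aop y i - Aop \<xi> i)\<^sup>2) \<le> gfun y - gfun \<xi>"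
  using gfun_minimizer_variational[OF assms] gfun_expand[of y \<xi> 1 "\<lambda>i. Aop y i - Aop \<xi> i"]
  by simp

lemma gstar_eq:
  assumes "\<xi> \<in> Bprod F" "\<And>y. y \<in> Bprod F \<Longrightarrow> gfun \<xi> \<le> gfun y"
  shows "gstar F = gfun \<xi>"
  unfolding gstar_def using assms by (intro cInf_eq_minimum) auto

lemma lovasz_ge:
  assumes "u \<in> base_polytope F"
  shows "(\<Sum>i\<in>UNIV. u i * x i) \<le> lovasz F x"
  unfolding lovasz_def
proof (rule cSup_upper)
  have "continuous_on (base_polytope F) (\<lambda>u. \<Sum>i\<in>UNIV. u i * x i)"
    by (intro continuous_intros continuous_on_coordinate)
  then show "bdd_above ((\<lambda>u. \<Sum>i\<in>UNIV. u i * x i) ` base_polytope F)"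
    by (intro bounded_imp_bdd_above compact_imp_bounded compact_continuous_image
        compact_base_polytope)
qed (use assms in auto)

lemma lovasz_eq:
  assumes "u \<in> base_polytope F"
    and "\<And>v. v \<in> base_polytope F \<Longrightarrow> (\<Sum>i\<in>UNIV. v i * x i) \<le> (\<Sum>i\<in>UNIV. u i * x i)"
  shows "lovasz F x = (\<Sum>i\<in>UNIV. u i * x i)"
  unfolding lovasz_def using assms by (intro cSup_eq_maximum) auto

lemma sum_blocks_mult: "(\<Sum>r\<in>UNIV. \<Sum>i\<in>UNIV. y r i * x i) = (\<Sum>i\<in>UNIV. Aop y i * x i)"
  unfolding Aop_def sum_distrib_right by (rule sum.swap)

text \<open>Strong duality. Each block of \<open>\<xi>\<close> maximizes the linear functional given
  by \<open>- Aop \<xi>\<close>, so there the Lovasz extensions equal inner products with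
  \<open>\<xi>\<close>; elsewhere these inner products are lower bounds.\<close>

lemma xstar_eq:
  fixes F :: "'r::finite \<Rightarrow> 'n::finite set \<Rightarrow> real"
  assumes \<xi>: "\<xi> \<in> Bprod F" and min: "\<And>y. y \<in> Bprod F \<Longrightarrow> gfun \<xi> \<le> gfun y"
  shows "xstar F = - Aop \<xi>"
proof -
  define p where
    "p x = (\<Sum>r\<in>UNIV. lovasz (F r) x) + 1/2 * (\<Sum>i\<in>UNIV. (x i)\<^sup>2)" for x
  have "lovasz (F r) (- Aop \<xi>) = (\<Sum>i\<in>UNIV. \<xi> r i * (- Aop \<xi>) i)" for r
  proof (rule lovasz_eq)
    show "\<xi> r \<in> base_polytope (F r)" using \<xi> by (simp add: Bprod_def)
    fix v assume v: "v \<in> base_polytope (F r)"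
    \<comment> \<open>Replacing a single block splits the joint optimality condition into one per
      block.\<close>
    have "\<xi>(r := v) \<in> Bprod F" using \<xi> v by (auto simp: Bprod_def)
    moreover have "Aop (\<xi>(r := v)) i - Aop \<xi> i = v i - \<xi> r i" for i
      unfolding Aop_def sum.remove[OF finite UNIV_I[of r]] by simp
    ultimately have "0 \<le> (\<Sum>i\<in>UNIV. Aop \<xi> i * (v i - \<xi> r i))"
      using gfun_minimizer_variational[OF \<xi> min, of "\<xi>(r := v)"] by simp
    then show "(\<Sum>i\<in>UNIV. v i * (- Aop \<xi>) i) \<le> (\<Sum>i\<in>UNIV. \<xi> r i * (- Aop \<xi>) i)"
      by (simp add: algebra_simps sum_subtractf sum_negf)
  qed
  then have "(\<Sum>r\<in>UNIV. lovasz (F r) (- Aop \<xi>)) = (\<Sum>i\<in>UNIV. Aop \<xi> i * (- Aop \<xi>) i)"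
    by (simp only: sum_blocks_mult)
  then have p_min: "p (- Aop \<xi>) = - (1/2) * (\<Sum>i\<in>UNIV. (Aop \<xi> i)\<^sup>2)"
    by (simp add: p_def sum_negf power2_eq_square)
  \<comment> \<open>Completing the square; the leftover square gives the uniqueness that
    \<open>THE\<close> requires.\<close>
  have p_ge: "p (- Aop \<xi>) + 1/2 * (\<Sum>i\<in>UNIV. (x i + Aop \<xi> i)\<^sup>2) \<le> p x" for x
  proof -
    have "(\<Sum>i\<in>UNIV. Aop \<xi> i * x i) \<le> (\<Sum>r\<in>UNIV. lovasz (F r) x)"
      unfolding sum_blocks_mult[symmetric]
      using \<xi> by (intro sum_mono lovasz_ge) (simp add: Bprod_def)
    moreover have "(\<Sum>i\<in>UNIV. (x i + Aop \<xi> i)\<^sup>2) = (\<Sum>i\<in>UNIV. (x i)\<^sup>2)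
        + 2 * (\<Sum>i\<in>UNIV. Aop \<xi> i * x i) + (\<Sum>i\<in>UNIV. (Aop \<xi> i)\<^sup>2)"
      by (simp add: power2_sum sum.distrib sum_distrib_left algebra_simps)
    ultimately show ?thesis unfolding p_min unfolding p_def by linarith
  qed
  have "p (- Aop \<xi>) \<le> p x" for x
    by (rule order_trans[OF _ p_ge]) (simp add: sum_nonneg)
  moreover have "x = - Aop \<xi>" if "\<forall>x'. p x \<le> p x'" for x
  proof -
    have "(\<Sum>i\<in>UNIV. (x i + Aop \<xi> i)\<^sup>2) \<le> 0"
      using p_ge[of x] that[rule_format, of "- Aop \<xi>"] by simp
    then have "\<forall>i. (x i + Aop \<xi> i)\<^sup>2 = 0"
      by (metis (no_types, lifting) UNIV_I finite order_antisym sum_nonneg sum_nonneg_eq_0_iff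
          zero_le_power2)
    then show ?thesis by (auto simp: fun_eq_iff eq_neg_iff_add_eq_0)
  qed
  ultimately show ?thesis
    unfolding xstar_def p_def[symmetric] by (intro the_equality) auto
qed

lemma Xi_eq:
  assumes "\<xi> \<in> Bprod F" "\<And>y. y \<in> Bprod F \<Longrightarrow> gfun \<xi> \<le> gfun y"
  shows "Xi F = {z \<in> Bprod F. Aop z = Aop \<xi>}"
  using xstar_eq[of \<xi> F] assms unfolding Xi_def by (simp add: fun_eq_iff)

section \<open>Exchanges in base polytopes\<close>

text \<open>Positive exchange capacity: every constraint that is tightened by moving mass from
  \<open>i\<close> to \<open>j\<close> has slack. For \<open>i = j\<close> this holds
  vacuously.\<close>

definition exchangeable :: "('n::finite set \<Rightarrow> real) \<Rightarrow> ('n \<Rightarrow> real) \<Rightarrow> 'n \<Rightarrow> 'n \<Rightarrow> bool" where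
  "exchangeable F z i j \<longleftrightarrow> (\<forall>S. j \<in> S \<longrightarrow> i \<notin> S \<longrightarrow> sum z S < F S)"

lemma exchangeable_feasible:
  assumes "z \<in> base_polytope F" "exchangeable F z i j"
  obtains e where "0 < e"
    "\<And>t. 0 \<le> t \<Longrightarrow> t \<le> e \<Longrightarrow>
      (\<lambda>k. z k + t * (of_bool (k = j) - of_bool (k = i))) \<in> base_polytope F"
proof
  \<comment> \<open>The added 1 keeps the set nonempty when no constraint limits the move, as for
    \<open>i = j\<close>.\<close>
  let ?X = "insert 1 ((\<lambda>S. F S - sum z S) ` {S. j \<in> S \<and> i \<notin> S})"
  show "0 < Min ?X"
    using assms(2) by (auto simp: exchangeable_def)
  fix t assume t: "0 \<le> t" "t \<le> Min ?X"
  have eq: "(\<Sum>k\<in>S. z k + t * (of_bool (k = j) - of_bool (k = i)))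
      = sum z S + t * (of_bool (j \<in> S) - of_bool (i \<in> S))" for S
    by (simp add: sum.distrib sum_subtractf of_bool_def flip: sum_distrib_left)
  have "sum z S + t * (of_bool (j \<in> S) - of_bool (i \<in> S)) \<le> F S" for S
  proof (cases "j \<in> S \<and> i \<notin> S")
    case True
    then have "t \<le> F S - sum z S" using t(2) by (auto intro: order_trans)
    then show ?thesis using True by simp
  next
    case False
    then have "t * (of_bool (j \<in> S) - of_bool (i \<in> S)) \<le> 0"
      using t(1) by auto
    then show ?thesis using base_polytopeD(1)[OF assms(1), of S] by linarith
  qed
  then show "(\<lambda>k. z k + t * (of_bool (k = j) - of_bool (k = i))) \<in> base_polytope F"
    unfolding base_polytope_def mem_Collect_eq eq using base_polytopeD(2)[OF assms(1)] by simp
qed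

text \<open>Uncrossing: \<open>sum z\<close> is modular, so submodularity leaves no slack for the
  union or the intersection.\<close>

lemma tight_Un_Int:
  assumes "submodular F" "z \<in> base_polytope F" "sum z S = F S" "sum z T = F T"
  shows "sum z (S \<union> T) = F (S \<union> T)" and "sum z (S \<inter> T) = F (S \<inter> T)"
proof -
  have "sum z (S \<union> T) + sum z (S \<inter> T) = sum z S + sum z T"
    by (rule sum.union_inter) auto
  moreover have "F (S \<union> T) + F (S \<inter> T) \<le> F S + F T"
    using assms(1) by (simp add: submodular_def)
  ultimately show "sum z (S \<union> T) = F (S \<union> T)" "sum z (S \<inter> T) = F (S \<inter> T)"
    using base_polytopeD(1)[OF assms(2), of "S \<union> T"]
      base_polytopeD(1)[OF assms(2), of "S \<inter> T"] assms(3,4) by linarith+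
qed

lemma tight_separation:
  assumes "submodular F" "F {} = 0" "z \<in> base_polytope F"
    and sep: "\<And>i j. i \<in> I \<Longrightarrow> j \<in> J \<Longrightarrow> \<not> exchangeable F z i j"
  obtains T where "sum z T = F T" "J \<subseteq> T" "T \<inter> I = {}"
proof -
  have tight: "\<exists>T. sum z T = F T \<and> j \<in> T \<and> i \<notin> T" if "i \<in> I" "j \<in> J" for i j
    using sep[OF that] base_polytopeD(1)[OF assms(3)] unfolding exchangeable_def
    by (metis order_antisym not_less)
  \<comment> \<open>For fixed \<open>j\<close>, intersect tight sets over \<open>I\<close>, starting
    from the tight set \<open>UNIV\<close>.\<close>
  have J1: "\<exists>T. sum z T = F T \<and> j \<in> T \<and> T \<inter> I = {}" if "j \<in> J" for j
    using finite[of I] tight[OF _ that]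
  proof (induction I rule: finite_induct)
    case empty
    then show ?case using base_polytopeD(2)[OF assms(3)] by auto
  next
    case (insert i I)
    then obtain T T' where "sum z T = F T \<and> j \<in> T \<and> T \<inter> I = {}"
      "sum z T' = F T' \<and> j \<in> T' \<and> i \<notin> T'" by (metis insertCI)
    then show ?case using tight_Un_Int(2)[OF assms(1,3), of T T'] by blast
  qed
  \<comment> \<open>Then unite over \<open>J\<close>, starting from \<open>{}\<close>, which is
    tight because \<open>F {} = 0\<close>.\<close>
  have "\<exists>T. sum z T = F T \<and> J \<subseteq> T \<and> T \<inter> I = {}"
    using finite[of J] J1
  proof (induction J rule: finite_induct)
    case empty
    then show ?case using assms(2) by (intro exI[of _ "{}"]) simp
  next
    case (insert j J)
    then obtain T T' where "sum z T = F T \<and> J \<subseteq> T \<and> T \<inter> I = {}"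
      "sum z T' = F T' \<and> j \<in> T' \<and> T' \<inter> I = {}" by (metis insertCI)
    then show ?case using tight_Un_Int(1)[OF assms(1,3), of T T'] by blast
  qed
  then show ?thesis using that by blast
qed

text \<open>A tight set \<open>T\<close> contains every deficit outside \<open>U\<close> and avoids
  every excess inside. Then \<open>z - y\<close> has nonnegative sum on \<open>T\<close> and on
  \<open>- U - T\<close>, nonpositive sum on \<open>T \<inter> U\<close>, hence nonnegative sum on
  \<open>- U\<close>; the totals agree.\<close>

lemma sum_le_if_no_exchange_out:
  assumes "submodular F" "F {} = 0" and y: "y \<in> base_polytope F" and z: "z \<in> base_polytope F"
    and closed: "\<And>i j. i \<in> U \<Longrightarrow> j \<notin> U \<Longrightarrow> y i < z i \<Longrightarrow> z j < y j \<Longrightarrow> \<not> exchangeable F z i j"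
  shows "sum z U \<le> sum y U"
proof -
  obtain T where T: "sum z T = F T" "{j. j \<notin> U \<and> z j < y j} \<subseteq> T" "T \<inter> {i \<in> U. y i < z i} = {}"
    using tight_separation[OF assms(1,2) z, of "{i \<in> U. y i < z i}" "{j. j \<notin> U \<and> z j < y j}"] closed
    by blast
  have split: "sum f S = sum f (S \<inter> V) + sum f (S - V)" for f :: "'a \<Rightarrow> real" and S V
    by (rule sum.Int_Diff) simp
  have "sum y T \<le> sum z T" using base_polytopeD(1)[OF y, of T] T(1) by simp
  moreover have "sum z (T \<inter> U) \<le> sum y (T \<inter> U)"
    using T(3) by (intro sum_mono) (auto simp: not_less[symmetric])
  moreover have "sum y (- U - T) \<le> sum z (- U - T)"
    using T(2) by (intro sum_mono) (auto simp: not_less[symmetric])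
  moreover have "sum z UNIV = sum y UNIV" using base_polytopeD(2) y z by metis
  moreover have "UNIV \<inter> U = U" "UNIV - U = - U" "- U \<inter> T = T - U" by auto
  ultimately show ?thesis
    using split[of y UNIV U] split[of z UNIV U] split[of y "- U" T] split[of z "- U" T]
      split[of y T U] split[of z T U] by simp
qed

text \<open>Positive and negative parts have equal mass, each half of the absolute sum.\<close>

lemma sum_subset_le_half_abs:
  fixes e :: "'a::finite \<Rightarrow> real"
  assumes "sum e UNIV = 0"
  shows "sum e U \<le> 1/2 * (\<Sum>j\<in>UNIV. \<bar>e j\<bar>)"
proof -
  have "sum e UNIV = sum e U + sum e (- U)" for e :: "'a \<Rightarrow> real"
    by (simp add: sum.union_disjoint[symmetric])
  note this[of e] this[of "\<lambda>j. \<bar>e j\<bar>"]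
  moreover have "sum e U \<le> (\<Sum>j\<in>U. \<bar>e j\<bar>)" "- sum e (- U) \<le> (\<Sum>j\<in>-U. \<bar>e j\<bar>)"
    by (auto intro: sum_mono simp flip: sum_negf)
  ultimately show ?thesis using assms by simp
qed

lemma sum_sq_le_sq_sum:
  fixes x :: "'a \<Rightarrow> real"
  assumes "finite A" "\<And>a. a \<in> A \<Longrightarrow> 0 \<le> x a"
  shows "(\<Sum>a\<in>A. (x a)\<^sup>2) \<le> (sum x A)\<^sup>2"
proof -
  have "x a * x a \<le> x a * sum x A" if "a \<in> A" for a
    using that assms by (intro mult_left_mono member_le_sum) auto
  then show ?thesis
    unfolding power2_eq_square sum_distrib_right by (intro sum_mono) auto
qed

section \<open>Closest points in a fibre of the sum map\<close>

lemma sum_Aop: "sum (Aop y) U = (\<Sum>r\<in>UNIV. sum (y r) U)"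
  unfolding Aop_def by (rule sum.swap)

lemma Aop_total:
  assumes "y \<in> Bprod F"
  shows "sum (Aop y) UNIV = (\<Sum>r\<in>UNIV. F r UNIV)"
  unfolding sum_Aop using assms by (intro sum.cong base_polytopeD(2)) (auto simp: Bprod_def)

text \<open>A path from \<open>i\<close> to \<open>j\<close> yields a feasible direction that brings
  \<open>z\<close> closer to \<open>y\<close> and changes \<open>Aop\<close> only at its endpoints.
  For a cycle the endpoints cancel, against the minimality of \<open>z\<close>.\<close>

lemma closest_point_exchange_acyclic:
  fixes F :: "'r::finite \<Rightarrow> 'n::finite set \<Rightarrow> real"
  assumes z: "z \<in> Bprod F"
    and min: "\<And>z'. z' \<in> Bprod F \<Longrightarrow> Aop z' = Aop z \<Longrightarrow>
      (\<Sum>r\<in>UNIV. \<Sum>i\<in>UNIV. (z r i - y r i)\<^sup>2) \<le> (\<Sum>r\<in>UNIV. \<Sum>i\<in>UNIV. (z' r i - y r i)\<^sup>2)"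
  shows "acyclic {(i, j). \<exists>r. y r i < z r i \<and> z r j < y r j \<and> exchangeable (F r) (z r) i j}"
    (is "acyclic ?E")
proof -
  \<comment> \<open>Half the directional derivative at \<open>z\<close> of the squared distance to
    \<open>y\<close>.\<close>
  define slope where "slope h = (\<Sum>r\<in>UNIV. \<Sum>k\<in>UNIV. (z r k - y r k) * h r k)" for h
  have path: "\<exists>h e. (\<forall>k. Aop h k = of_bool (k = j) - of_bool (k = i)) \<and> slope h < 0 \<and> 0 < e \<and>
      (\<forall>t. 0 \<le> t \<longrightarrow> t \<le> e \<longrightarrow> (\<lambda>r k. z r k + t * h r k) \<in> Bprod F)"
    if "(i, j) \<in> ?E\<^sup>+" for i j
    using that
  proof (induction i j rule: trancl_trans_induct[consumes 1, case_names step trans])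
    case (step i j)
    then obtain r where r: "y r i < z r i" "z r j < y r j" "exchangeable (F r) (z r) i j" by blast
    obtain e where e: "0 < e" "\<And>t. 0 \<le> t \<Longrightarrow> t \<le> e \<Longrightarrow>
        (\<lambda>k. z r k + t * (of_bool (k = j) - of_bool (k = i))) \<in> base_polytope (F r)"
      using exchangeable_feasible[OF _ r(3)] z by (auto simp: Bprod_def)
    define h where "h = (\<lambda>r' k. if r' = r then of_bool (k = j) - of_bool (k = i) else 0 :: real)"
    have "Aop h k = of_bool (k = j) - of_bool (k = i)" for k
      by (simp add: Aop_def h_def)
    moreover have "slope h = (\<Sum>k\<in>UNIV. (z r k - y r k) * (of_bool (k = j) - of_bool (k = i)))"
      unfolding slope_def sum.remove[OF finite UNIV_I[of r]] by (simp add: h_def)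
    then have "slope h = (z r j - y r j) - (z r i - y r i)"
      by (simp add: right_diff_distrib sum_subtractf sum_mult_of_bool_eq)
    then have "slope h < 0" using r by simp
    moreover have "(\<lambda>r k. z r k + t * h r k) \<in> Bprod F" if "0 \<le> t" "t \<le> e" for t
    proof -
      have "(\<lambda>k. z r' k + t * h r' k) \<in> base_polytope (F r')" for r'
        using z e(2)[OF that] by (cases "r' = r") (simp_all add: Bprod_def h_def)
      then show ?thesis by (simp add: Bprod_def)
    qed
    ultimately show ?case using e(1) by blast
  next
    case (trans i j l)
    from trans.IH(1) obtain h e where h: "\<forall>k. Aop h k = of_bool (k = j) - of_bool (k = i)"
        "slope h < 0" "0 < e" "\<forall>t. 0 \<le> t \<longrightarrow> t \<le> e \<longrightarrow> (\<lambda>r k. z r k + t * h r k) \<in> Bprod F"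
      by (elim exE conjE)
    from trans.IH(2) obtain h' e' where h': "\<forall>k. Aop h' k = of_bool (k = l) - of_bool (k = j)"
        "slope h' < 0" "0 < e'" "\<forall>t. 0 \<le> t \<longrightarrow> t \<le> e' \<longrightarrow> (\<lambda>r k. z r k + t * h' r k) \<in> Bprod F"
      by (elim exE conjE)
    let ?h = "\<lambda>r k. h r k + h' r k"
    \<comment> \<open>The combined step is the midpoint of two doubled steps, so convexity suffices
      even though the first exchange may alter the tight sets that govern the second; hence the
      bound \<open>min e e' / 2\<close>.\<close>
    have "(\<lambda>r k. z r k + t * ?h r k) \<in> Bprod F" if t: "0 \<le> t" "t \<le> min e e' / 2" for t
    proof -
      have "(\<lambda>r k. z r k + (2*t) * h r k) \<in> Bprod F" "(\<lambda>r k. z r k + (2*t) * h' r k) \<in> Bprod F"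
        using h(4) h'(4) t by auto
      from Bprod_convex[OF this, of "1/2"] show ?thesis
        by (simp add: algebra_simps)
    qed
    moreover have "Aop ?h k = of_bool (k = l) - of_bool (k = i)" for k
      using h(1) h'(1) by (simp add: Aop_def sum.distrib)
    moreover have "slope ?h = slope h + slope h'"
      by (simp add: slope_def distrib_left sum.distrib)
    moreover have "0 < min e e' / 2" using h(3) h'(3) by simp
    ultimately show ?case
      using h(2) h'(2) by (intro exI[of _ ?h] exI[of _ "min e e' / 2"]) auto
  qed
  show ?thesis
  proof (rule acyclicI, intro allI notI)
    fix i assume "(i, i) \<in> ?E\<^sup>+"
    then obtain h e where h: "\<And>k. Aop h k = 0" "slope h < 0" "0 < e"
      "\<And>t. 0 \<le> t \<Longrightarrow> t \<le> e \<Longrightarrow> (\<lambda>r k. z r k + t * h r k) \<in> Bprod F"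
      using path by fastforce
    have "0 \<le> 2 * e * slope h"
    proof (rule first_order_nonneg)
      fix t :: real assume t: "0 < t" "t \<le> 1"
      \<comment> \<open>Feasibility is known only for steps up to \<open>e\<close>, so the parameter
        is rescaled to the unit interval.\<close>
      let ?z = "\<lambda>r k. z r k + (t * e) * h r k"
      have "?z \<in> Bprod F" using t h(3) by (intro h(4)) (auto simp: mult_left_le_one_le)
      moreover have "Aop ?z = Aop z"
        using h(1) by (auto simp: Aop_def sum.distrib simp flip: sum_distrib_left)
      ultimately have "(\<Sum>r\<in>UNIV. \<Sum>i\<in>UNIV. (z r i - y r i)\<^sup>2)
          \<le> (\<Sum>r\<in>UNIV. \<Sum>i\<in>UNIV. (?z r i - y r i)\<^sup>2)"
        by (rule min)
      also have "(?z r i - y r i)\<^sup>2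
          = (z r i - y r i)\<^sup>2 + t * (2 * e * ((z r i - y r i) * h r i)) + t\<^sup>2 * (e\<^sup>2 * (h r i)\<^sup>2)" for r i
        by (simp add: power2_eq_square algebra_simps)
      then have "(\<Sum>r\<in>UNIV. \<Sum>i\<in>UNIV. (?z r i - y r i)\<^sup>2)
          = (\<Sum>r\<in>UNIV. \<Sum>i\<in>UNIV. (z r i - y r i)\<^sup>2) + t * (2 * e * slope h)
            + t\<^sup>2 * (e\<^sup>2 * (\<Sum>r\<in>UNIV. \<Sum>i\<in>UNIV. (h r i)\<^sup>2))"
        by (simp only: sum.distrib slope_def flip: sum_distrib_left)
      finally show "0 \<le> t * (2 * e * slope h) + t\<^sup>2 * (e\<^sup>2 * (\<Sum>r\<in>UNIV. \<Sum>i\<in>UNIV. (h r i)\<^sup>2))"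
        by simp
    qed
    then show False using h(2,3) by (simp add: zero_le_mult_iff)
  qed
qed

lemma closest_point_flow_bound:
  fixes F :: "'r::finite \<Rightarrow> 'n::finite set \<Rightarrow> real"
  assumes sub: "\<And>r. submodular (F r)" and zero: "\<And>r. F r {} = 0"
    and y: "y \<in> Bprod F" and z: "z \<in> Bprod F"
    and min: "\<And>z'. z' \<in> Bprod F \<Longrightarrow> Aop z' = Aop z \<Longrightarrow>
      (\<Sum>r\<in>UNIV. \<Sum>i\<in>UNIV. (z r i - y r i)\<^sup>2) \<le> (\<Sum>r\<in>UNIV. \<Sum>i\<in>UNIV. (z' r i - y r i)\<^sup>2)"
  defines "V \<equiv> 1/2 * (\<Sum>j\<in>UNIV. \<bar>Aop y j - Aop z j\<bar>)"
  shows "(\<Sum>r\<in>UNIV. max 0 (z r i - y r i)) \<le> V"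
    and "(\<Sum>r\<in>UNIV. max 0 (y r i - z r i)) \<le> V"
proof -
  define E where
    "E = {(i, j). \<exists>r. y r i < z r i \<and> z r j < y r j \<and> exchangeable (F r) (z r) i j}"
  have acyc: "(k, k) \<notin> E\<^sup>+" for k
    using closest_point_exchange_acyclic[OF z min] by (auto simp: acyclic_def E_def)
  have yr: "y r \<in> base_polytope (F r)" and zr: "z r \<in> base_polytope (F r)" for r
    using y z by (auto simp: Bprod_def)
  have cut: "sum (z r) U \<le> sum (y r) U" if "\<And>k l. (k, l) \<in> E \<Longrightarrow> k \<in> U \<Longrightarrow> l \<in> U" for U r
    using that by (intro sum_le_if_no_exchange_out[OF sub zero yr zr]) (auto simp: E_def)
  have total: "sum (Aop y) UNIV = sum (Aop z) UNIV"
    using Aop_total[OF y] Aop_total[OF z] by simp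

  define U where "U = {k. (i, k) \<in> E\<^sup>+}"
  have "max 0 (z r i - y r i) \<le> sum (y r) U - sum (z r) U" for r
  proof -
    have "sum (z r) U \<le> sum (y r) U"
      by (rule cut) (auto simp: U_def intro: trancl_into_trancl)
    \<comment> \<open>Both \<open>U\<close> and \<open>insert i U\<close> are closed under arcs.
      Acyclicity keeps \<open>i\<close> out of \<open>U\<close>, so the second cut isolates
      coordinate \<open>i\<close>.\<close>
    moreover have "sum (z r) (insert i U) \<le> sum (y r) (insert i U)"
      by (rule cut) (auto simp: U_def intro: trancl_into_trancl)
    moreover have "i \<notin> U" using acyc by (simp add: U_def)
    ultimately show ?thesis by simp
  qed
  then have "(\<Sum>r\<in>UNIV. max 0 (z r i - y r i)) \<le> (\<Sum>j\<in>U. Aop y j - Aop z j)"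
    unfolding sum_subtractf sum_Aop by (simp only: sum_mono flip: sum_subtractf)
  also have "\<dots> \<le> V"
    unfolding V_def by (rule sum_subset_le_half_abs) (simp add: sum_subtractf total)
  finally show "(\<Sum>r\<in>UNIV. max 0 (z r i - y r i)) \<le> V" .

  \<comment> \<open>No arc leaves the complement of \<open>W\<close> or of
    \<open>insert i W\<close>; equal totals reverse these cuts into cuts for
    \<open>W\<close>.\<close>
  define W where "W = {k. (k, i) \<in> E\<^sup>+}"
  have compl: "sum f (- A) = sum f UNIV - sum f A" for f :: "'n \<Rightarrow> real" and A
    by (simp add: Compl_eq_Diff_UNIV sum_diff)
  have "max 0 (y r i - z r i) \<le> sum (z r) W - sum (y r) W" for r
  proof -
    have "sum (z r) (- W) \<le> sum (y r) (- W)"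
      by (rule cut) (auto simp: W_def intro: trancl_into_trancl2)
    moreover have "sum (z r) (- insert i W) \<le> sum (y r) (- insert i W)"
      by (rule cut) (auto simp: W_def intro: trancl_into_trancl2)
    moreover have "i \<notin> W" using acyc by (simp add: W_def)
    moreover have "sum (z r) UNIV = sum (y r) UNIV"
      using base_polytopeD(2)[OF yr] base_polytopeD(2)[OF zr] by simp
    ultimately show ?thesis by (simp add: compl)
  qed
  then have "(\<Sum>r\<in>UNIV. max 0 (y r i - z r i)) \<le> (\<Sum>j\<in>W. Aop z j - Aop y j)"
    unfolding sum_subtractf sum_Aop by (simp only: sum_mono flip: sum_subtractf)
  also have "\<dots> \<le> 1/2 * (\<Sum>j\<in>UNIV. \<bar>Aop z j - Aop y j\<bar>)"
    by (rule sum_subset_le_half_abs) (simp add: sum_subtractf total)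
  also have "\<dots> = V"
    by (simp add: V_def abs_minus_commute)
  finally show "(\<Sum>r\<in>UNIV. max 0 (y r i - z r i)) \<le> V" .
qed

lemma norm1inf_coordinate:
  assumes "i \<in> S r"
  shows "\<theta> r i \<le> Max {\<theta> r i | r::'r::finite. i \<in> S r}"
  using assms by (intro Max_ge) auto

text \<open>The point is closest in the unweighted norm; weights enter afterwards, through their
  maximum \<open>M i\<close> at each coordinate. Excess and deficit at \<open>i\<close> contribute
  at most \<open>V\<^sup>2\<close> each, since a sum of squares of nonnegative numbers is at most
  the square of their sum.\<close>

lemma fibre_point_close:
  fixes F :: "'r::finite \<Rightarrow> 'n::finite set \<Rightarrow> real"
  assumes sub: "\<And>r. submodular (F r)" and zero: "\<And>r. F r {} = 0"
    and cover: "\<And>i. \<exists>r. i \<in> supp_set (F r)" and \<theta>: "\<And>r i. 0 \<le> \<theta> r i"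
    and y: "y \<in> Bprod F" and \<xi>: "\<xi> \<in> Bprod F"
  obtains z where "z \<in> Bprod F" "Aop z = Aop \<xi>"
    "(\<Sum>r\<in>UNIV. \<Sum>i\<in>UNIV. \<theta> r i * (y r i - z r i)\<^sup>2)
      \<le> real CARD('n) * norm1inf (\<lambda>r. supp_set (F r)) \<theta> / 2 * (\<Sum>i\<in>UNIV. (Aop y i - Aop \<xi> i)\<^sup>2)"
proof -
  define M where "M i = Max {\<theta> r i | r. i \<in> supp_set (F r)}" for i
  define V where "V = 1/2 * (\<Sum>j\<in>UNIV. \<bar>Aop y j - Aop \<xi> j\<bar>)"
  let ?K = "{z \<in> Bprod F. Aop z = Aop \<xi>}"
  let ?q = "\<lambda>z. \<Sum>r\<in>UNIV. \<Sum>i\<in>UNIV. (z r i - y r i)\<^sup>2"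
  have "continuous_on ?K ?q"
    by (intro continuous_intros continuous_on_block_coordinate)
  moreover have "?K \<noteq> {}" using \<xi> by blast
  ultimately obtain z where z: "z \<in> Bprod F" "Aop z = Aop \<xi>"
    and min: "\<And>z'. z' \<in> Bprod F \<Longrightarrow> Aop z' = Aop \<xi> \<Longrightarrow> ?q z \<le> ?q z'"
    using continuous_attains_inf[OF compact_Bprod_fibre] by blast
  have pos: "(\<Sum>r\<in>UNIV. max 0 (z r i - y r i)) \<le> V"
    and neg: "(\<Sum>r\<in>UNIV. max 0 (y r i - z r i)) \<le> V" for i
    using closest_point_flow_bound[OF sub zero y z(1)] min z(2) unfolding V_def by simp_all
  have M0: "0 \<le> M i" for i
    using cover[of i] norm1inf_coordinate[of i "\<lambda>r. supp_set (F r)" _ \<theta>] \<theta> unfolding M_def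
    by (meson order_trans)
  have "(\<Sum>r\<in>UNIV. \<theta> r i * (y r i - z r i)\<^sup>2) \<le> M i * (2 * V\<^sup>2)" for i
  proof -
    have "\<theta> r i * (y r i - z r i)\<^sup>2 \<le> M i * ((max 0 (z r i - y r i))\<^sup>2 + (max 0 (y r i - z r i))\<^sup>2)" for r
    proof (cases "i \<in> supp_set (F r)")
      case True
      have "\<theta> r i * (y r i - z r i)\<^sup>2 \<le> M i * (y r i - z r i)\<^sup>2"
        unfolding M_def using True by (intro mult_right_mono norm1inf_coordinate) auto
      also have "\<dots> = M i * ((max 0 (z r i - y r i))\<^sup>2 + (max 0 (y r i - z r i))\<^sup>2)"
        by (simp add: max_def power2_commute)
      finally show ?thesis .
    next
      case False
      \<comment> \<open>The maximum \<open>M i\<close> ranges over incident blocks only; in the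
        others both points vanish at \<open>i\<close>.\<close>
      then have "y r i = 0" "z r i = 0"
        using base_polytope_vanish[OF zero _ False] y z by (auto simp: Bprod_def)
      then show ?thesis using M0[of i] by simp
    qed
    then have "(\<Sum>r\<in>UNIV. \<theta> r i * (y r i - z r i)\<^sup>2)
        \<le> M i * ((\<Sum>r\<in>UNIV. (max 0 (z r i - y r i))\<^sup>2) + (\<Sum>r\<in>UNIV. (max 0 (y r i - z r i))\<^sup>2))"
      unfolding sum.distrib[symmetric] sum_distrib_left by (intro sum_mono) simp
    also have "\<dots> \<le> M i * (V\<^sup>2 + V\<^sup>2)"
      using pos[of i] neg[of i]
      by (intro mult_left_mono add_mono order_trans[OF sum_sq_le_sq_sum] power_mono M0)
        (auto intro: sum_nonneg)
    finally show ?thesis by simp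
  qed
  then have "(\<Sum>i\<in>UNIV. \<Sum>r\<in>UNIV. \<theta> r i * (y r i - z r i)\<^sup>2) \<le> (\<Sum>i\<in>UNIV. M i) * (2 * V\<^sup>2)"
    unfolding sum_distrib_right by (intro sum_mono) simp
  \<comment> \<open>Cauchy-Schwarz over the coordinates, the source of the factor
    \<open>CARD('n)\<close>.\<close>
  also have "(2 * V)\<^sup>2 \<le> real CARD('n) * (\<Sum>i\<in>UNIV. (Aop y i - Aop \<xi> i)\<^sup>2)"
    using sum_squared_le_sum_of_squares[of "\<lambda>j. \<bar>Aop y j - Aop \<xi> j\<bar>" UNIV]
    by (simp add: V_def mult.commute)
  then have "(\<Sum>i\<in>UNIV. M i) * (2 * V\<^sup>2)
      \<le> (\<Sum>i\<in>UNIV. M i) * (real CARD('n) * (\<Sum>i\<in>UNIV. (Aop y i - Aop \<xi> i)\<^sup>2) / 2)"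
    by (intro mult_left_mono sum_nonneg M0) (simp add: power_mult_distrib)
  finally have "(\<Sum>r\<in>UNIV. \<Sum>i\<in>UNIV. \<theta> r i * (y r i - z r i)\<^sup>2)
      \<le> real CARD('n) * norm1inf (\<lambda>r. supp_set (F r)) \<theta> / 2 * (\<Sum>i\<in>UNIV. (Aop y i - Aop \<xi> i)\<^sup>2)"
    unfolding norm1inf_def M_def by (subst sum.swap) (simp add: algebra_simps)
  then show ?thesis using that z by blast
qed

section \<open>Convergence of parallel coordinate descent\<close>

lemma wnorm_sq: "(\<And>i. 0 \<le> w i) \<Longrightarrow> (wnorm w z)\<^sup>2 = (\<Sum>i\<in>UNIV. w i * (z i)\<^sup>2)"
  by (simp add: wnorm_def sum_nonneg)

text \<open>Compactness provides a minimizer for \<open>SOME\<close> to pick. Zero weights can make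
  it non-unique, so later arguments rest on membership and minimality alone.\<close>

lemma wproj_minimizes:
  fixes F :: "'n::finite set \<Rightarrow> real" and w u :: "'n \<Rightarrow> real"
  assumes "y \<in> base_polytope F" "\<And>i. 0 \<le> w i"
  defines "p \<equiv> wproj (base_polytope F) w u"
  shows "p \<in> base_polytope F"
    and "z \<in> base_polytope F \<Longrightarrow>
      (\<Sum>i\<in>UNIV. w i * (p i - u i)\<^sup>2) \<le> (\<Sum>i\<in>UNIV. w i * (z i - u i)\<^sup>2)"
proof -
  have "continuous_on (base_polytope F) (\<lambda>z. wnorm w (z - u))"
    unfolding wnorm_def minus_apply by (intro continuous_intros continuous_on_coordinate)
  then have "\<exists>z. z \<in> base_polytope F \<and> (\<forall>z'\<in>base_polytope F. wnorm w (z - u) \<le> wnorm w (z' - u))"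
    using continuous_attains_inf[OF compact_base_polytope] assms(1) by blast
  then have p: "p \<in> base_polytope F \<and> (\<forall>z'\<in>base_polytope F. wnorm w (p - u) \<le> wnorm w (z' - u))"
    unfolding p_def wproj_def by (rule someI_ex)
  then show "p \<in> base_polytope F" by blast
  assume "z \<in> base_polytope F"
  with p show "(\<Sum>i\<in>UNIV. w i * (p i - u i)\<^sup>2) \<le> (\<Sum>i\<in>UNIV. w i * (z i - u i)\<^sup>2)"
    by (simp add: wnorm_def)
qed

text \<open>Coordinates of weight 0 drop out of the weighted norm, and there the division in the
  projected point is by 0; hence the hypothesis that they vanish on the polytope.\<close>

lemma wproj_three_point:
  fixes F :: "'n::finite set \<Rightarrow> real" and w y c :: "'n \<Rightarrow> real"
  assumes y: "y \<in> base_polytope F" and w: "\<And>i. 0 \<le> w i" and z: "z \<in> base_polytope F"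
    and vanish: "\<forall>u\<in>base_polytope F. \<forall>i. w i = 0 \<longrightarrow> u i = 0"
  defines "p \<equiv> wproj (base_polytope F) w (y - (\<lambda>i. c i / w i))"
  shows "(\<Sum>i\<in>UNIV. c i * (p i - y i)) + 1/2 * (\<Sum>i\<in>UNIV. w i * (p i - y i)\<^sup>2)
      + 1/2 * (\<Sum>i\<in>UNIV. w i * (p i - z i)\<^sup>2)
    \<le> (\<Sum>i\<in>UNIV. c i * (z i - y i)) + 1/2 * (\<Sum>i\<in>UNIV. w i * (y i - z i)\<^sup>2)"
proof -
  define u where "u i = y i - c i / w i" for i
  have p: "p \<in> base_polytope F"
    unfolding p_def by (rule wproj_minimizes(1)[OF y w])
  \<comment> \<open>The first-order condition at the projection, in the direction of
    \<open>z\<close>.\<close>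
  have "0 \<le> 2 * (\<Sum>i\<in>UNIV. w i * (p i - u i) * (z i - p i))"
  proof (rule first_order_nonneg)
    fix t :: real assume t: "0 < t" "t \<le> 1"
    have "(\<Sum>i\<in>UNIV. w i * (p i - u i)\<^sup>2) \<le> (\<Sum>i\<in>UNIV. w i * (p i + t * (z i - p i) - u i)\<^sup>2)"
      using wproj_minimizes(2)[OF y w base_polytope_convex[OF p z, of t],
          where u = "y - (\<lambda>i. c i / w i)"] t
      by (simp add: p_def u_def)
    also have "w i * (p i + t * (z i - p i) - u i)\<^sup>2 = w i * (p i - u i)\<^sup>2
        + t * (2 * (w i * (p i - u i) * (z i - p i))) + t\<^sup>2 * (w i * (z i - p i)\<^sup>2)" for i
      by (simp add: power2_eq_square algebra_simps)
    then have "(\<Sum>i\<in>UNIV. w i * (p i + t * (z i - p i) - u i)\<^sup>2) = (\<Sum>i\<in>UNIV. w i * (p i - u i)\<^sup>2)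
        + t * (2 * (\<Sum>i\<in>UNIV. w i * (p i - u i) * (z i - p i)))
        + t\<^sup>2 * (\<Sum>i\<in>UNIV. w i * (z i - p i)\<^sup>2)"
      by (simp only: sum.distrib flip: sum_distrib_left)
    finally show "0 \<le> t * (2 * (\<Sum>i\<in>UNIV. w i * (p i - u i) * (z i - p i)))
        + t\<^sup>2 * (\<Sum>i\<in>UNIV. w i * (z i - p i)\<^sup>2)"
      by simp
  qed
  moreover have "w i * (p i - u i) * (z i - p i) = c i * (z i - p i) + w i * (p i - y i) * (z i - p i)" for i
  proof (cases "w i = 0")
    case True
    then have "z i = 0" "p i = 0" using vanish z p by blast+
    then show ?thesis using True by simp
  qed (simp add: u_def field_simps)
  ultimately have "0 \<le> (\<Sum>i\<in>UNIV. c i * (z i - p i) + w i * (p i - y i) * (z i - p i))"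
    by simp
  \<comment> \<open>Polarization: twice \<open>(p i - y i) * (z i - p i)\<close> is the square of
    \<open>y i - z i\<close> minus those of \<open>p i - y i\<close> and
    \<open>p i - z i\<close>.\<close>
  also have "\<dots> = (\<Sum>i\<in>UNIV. (c i * (z i - y i) + 1/2 * (w i * (y i - z i)\<^sup>2))
      - (c i * (p i - y i) + 1/2 * (w i * (p i - y i)\<^sup>2) + 1/2 * (w i * (p i - z i)\<^sup>2)))"
    by (intro sum.cong) (simp_all add: power2_eq_square field_simps)
  also have "\<dots> = (\<Sum>i\<in>UNIV. c i * (z i - y i)) + 1/2 * (\<Sum>i\<in>UNIV. w i * (y i - z i)\<^sup>2)
      - ((\<Sum>i\<in>UNIV. c i * (p i - y i)) + 1/2 * (\<Sum>i\<in>UNIV. w i * (p i - y i)\<^sup>2)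
      + 1/2 * (\<Sum>i\<in>UNIV. w i * (p i - z i)\<^sup>2))"
    by (simp only: sum_subtractf sum.distrib flip: sum_distrib_left)
  finally show ?thesis by simp
qed

section \<open>The weighted block distance\<close>

lemma blocknorm_sq:
  assumes "\<And>r i. 0 \<le> \<theta> r i"
  shows "(blocknorm \<theta> y)\<^sup>2 = (\<Sum>r\<in>UNIV. \<Sum>i\<in>UNIV. \<theta> r i * (y r i)\<^sup>2)"
  using assms by (simp add: blocknorm_def wnorm_sq sum_nonneg)

lemma dist_theta_sq_le:
  fixes \<theta> :: "'r::finite \<Rightarrow> 'n::finite \<Rightarrow> real"
  assumes "\<And>r i. 0 \<le> \<theta> r i" "z \<in> K"
  shows "(dist_theta \<theta> y K)\<^sup>2 \<le> (\<Sum>r\<in>UNIV. \<Sum>i\<in>UNIV. \<theta> r i * (y r i - z r i)\<^sup>2)"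
proof -
  have nonneg: "0 \<le> blocknorm \<theta> v" for v :: "'r \<Rightarrow> 'n \<Rightarrow> real"
    by (simp add: blocknorm_def sum_nonneg)
  have "dist_theta \<theta> y K \<le> blocknorm \<theta> (y - z)"
    unfolding dist_theta_def using assms(2)
    by (intro cInf_lower bdd_belowI[of _ 0]) (auto simp: nonneg)
  moreover have "0 \<le> dist_theta \<theta> y K"
    unfolding dist_theta_def using assms(2) by (intro cInf_greatest) (auto simp: nonneg)
  ultimately have "(dist_theta \<theta> y K)\<^sup>2 \<le> (blocknorm \<theta> (y - z))\<^sup>2"
    by (rule power_mono)
  then show ?thesis by (simp add: blocknorm_sq[OF assms(1)])
qed

lemma dist_theta_attained:
  assumes "\<And>r i. 0 \<le> \<theta> r i" "compact K" "K \<noteq> {}"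
  obtains z where "z \<in> K"
    "(dist_theta \<theta> y K)\<^sup>2 = (\<Sum>r\<in>UNIV. \<Sum>i\<in>UNIV. \<theta> r i * (y r i - z r i)\<^sup>2)"
proof -
  have "continuous_on K (\<lambda>z. blocknorm \<theta> (y - z))"
    unfolding blocknorm_def wnorm_def minus_apply
    by (intro continuous_intros continuous_on_block_coordinate)
  then obtain z where z: "z \<in> K" "\<And>z'. z' \<in> K \<Longrightarrow> blocknorm \<theta> (y - z) \<le> blocknorm \<theta> (y - z')"
    using continuous_attains_inf[OF assms(2,3)] by blast
  have "dist_theta \<theta> y K = blocknorm \<theta> (y - z)"
    unfolding dist_theta_def using z by (intro cInf_eq_minimum) auto
  then show ?thesis using that[OF z(1)] by (simp add: blocknorm_sq[OF assms(1)])
qed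

section \<open>Expectations over the sampled set\<close>

lemma alpha_proper_expectation:
  fixes P :: "'r::finite set pmf"
  assumes "alpha_proper P \<alpha>"
  shows "measure_pmf.expectation P (\<lambda>C. of_bool (r \<in> C)) = \<alpha>"
proof -
  have "(\<lambda>C. of_bool (r \<in> C)) = (indicator {C. r \<in> C} :: 'r set \<Rightarrow> real)"
    by (auto simp: indicator_def)
  then show ?thesis using assms by (simp add: alpha_proper_def)
qed

lemma thetaP_expectation:
  assumes "alpha_proper P \<alpha>"
  shows "measure_pmf.expectation P (\<lambda>C. if r \<in> C then real (mu S C i) else 0) = \<alpha> * thetaP S P r i"
  using assms by (simp add: thetaP_def alpha_proper_def)

lemma thetaP_nonneg: "0 \<le> thetaP S P r i"
  unfolding thetaP_def by (intro divide_nonneg_nonneg integral_nonneg_AE) auto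

lemma thetaP_ge_1:
  fixes P :: "'r::finite set pmf"
  assumes "alpha_proper P \<alpha>" "i \<in> S r"
  shows "1 \<le> thetaP S P r i"
proof -
  have "of_bool (r \<in> C) \<le> (if r \<in> C then real (mu S C i) else 0)" for C
  proof (cases "r \<in> C")
    case True
    \<comment> \<open>A drawn block incident to \<open>i\<close> is itself counted.\<close>
    then have "mu S C i \<noteq> 0" using assms(2) by (auto simp: mu_def)
    then show ?thesis using True by simp
  qed simp
  then have "measure_pmf.expectation P (\<lambda>C. of_bool (r \<in> C))
      \<le> measure_pmf.expectation P (\<lambda>C. if r \<in> C then real (mu S C i) else 0)"
    by (intro integral_mono integrable_measure_pmf_finite) auto
  then have "\<alpha> \<le> \<alpha> * thetaP S P r i"
    by (simp only: thetaP_expectation[OF assms(1)] alpha_proper_expectation[OF assms(1)])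
  then show ?thesis using assms(1) by (simp add: alpha_proper_def)
qed

text \<open>Transfers a bound valid for each drawn set to the expectation: by linearity, drawing
  block \<open>r\<close> contributes the factor \<alpha>, and the incidence counts turn into the
  weights.\<close>

lemma alpha_proper_expectation_affine:
  fixes P :: "'r::finite set pmf" and b :: "'r \<Rightarrow> 'n::finite \<Rightarrow> real"
  assumes "alpha_proper P \<alpha>"
    and "\<And>C. f C \<le> c + (\<Sum>r\<in>UNIV. a r * of_bool (r \<in> C)
      + (\<Sum>i\<in>UNIV. b r i * (if r \<in> C then real (mu S C i) else 0)))"
  shows "measure_pmf.expectation P f
    \<le> c + \<alpha> * (\<Sum>r\<in>UNIV. a r + (\<Sum>i\<in>UNIV. thetaP S P r i * b r i))"
proof -
  have int: "integrable P g" for g :: "'r set \<Rightarrow> real"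
    by (rule integrable_measure_pmf_finite) simp
  have "measure_pmf.expectation P f \<le> measure_pmf.expectation P (\<lambda>C. c + (\<Sum>r\<in>UNIV. a r * of_bool (r \<in> C)
      + (\<Sum>i\<in>UNIV. b r i * (if r \<in> C then real (mu S C i) else 0))))"
    using assms(2) by (intro integral_mono int)
  also have "\<dots> = c + (\<Sum>r\<in>UNIV. a r * measure_pmf.expectation P (\<lambda>C. of_bool (r \<in> C))
      + (\<Sum>i\<in>UNIV. b r i * measure_pmf.expectation P (\<lambda>C. if r \<in> C then real (mu S C i) else 0)))"
    by (simp only: Bochner_Integration.integral_add Bochner_Integration.integral_sum
        integral_mult_right int measure_pmf.prob_space lebesgue_integral_const) simp
  also have "\<dots> = c + \<alpha> * (\<Sum>r\<in>UNIV. a r + (\<Sum>i\<in>UNIV. thetaP S P r i * b r i))"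
    unfolding alpha_proper_expectation[OF assms(1)] thetaP_expectation[OF assms(1)]
    by (simp add: sum_distrib_left distrib_left mult_ac)
  finally show ?thesis .
qed

section \<open>Contraction of the potential, relative to a fixed minimizer\<close>

locale coordinate_descent =
  fixes F :: "'r::finite \<Rightarrow> 'n::finite set \<Rightarrow> real" and P :: "'r set pmf" and \<alpha> :: real
    and \<xi> :: "'r \<Rightarrow> 'n \<Rightarrow> real"
  assumes submodular: "submodular (F r)"
    and empty: "F r {} = 0"
    and cover: "\<exists>r. i \<in> supp_set (F r)"
    and proper: "alpha_proper P \<alpha>"
    and \<xi>: "\<xi> \<in> Bprod F"
    and \<xi>_min: "y \<in> Bprod F \<Longrightarrow> gfun \<xi> \<le> gfun y"
begin

definition "\<theta> = thetaF F P"

definition "M = real CARD('n) * norm1inf (\<lambda>r. supp_set (F r)) \<theta>"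

definition potential :: "('r \<Rightarrow> 'n \<Rightarrow> real) \<Rightarrow> real" where
  "potential y = gfun y - gstar F + 1/2 * (dist_theta \<theta> y (Xi F))\<^sup>2"

lemma theta_nonneg: "0 \<le> \<theta> r i"
  by (simp add: \<theta>_def thetaF_def thetaP_nonneg)

lemma theta_ge_1: "i \<in> supp_set (F r) \<Longrightarrow> 1 \<le> \<theta> r i"
  unfolding \<theta>_def thetaF_def by (rule thetaP_ge_1[OF proper])

lemma Bprod_vanish: "y \<in> Bprod F \<Longrightarrow> i \<notin> supp_set (F r) \<Longrightarrow> y r i = 0"
  using base_polytope_vanish[of "F r" "y r" i] empty by (simp add: Bprod_def)

lemma Xi_fibre: "Xi F = {z \<in> Bprod F. Aop z = Aop \<xi>}"
  by (rule Xi_eq[OF \<xi> \<xi>_min])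

lemma gstar_gfun: "gstar F = gfun \<xi>"
  by (rule gstar_eq[OF \<xi> \<xi>_min])

text \<open>Each coordinate is incident to some block, where its weight is at least 1.\<close>

lemma M_ge: "(real CARD('n))\<^sup>2 \<le> M"
proof -
  have "1 \<le> Max {\<theta> r i | r. i \<in> supp_set (F r)}" for i
    using cover[of i] theta_ge_1 norm1inf_coordinate[of i "\<lambda>r. supp_set (F r)" _ \<theta>]
    by (meson order_trans)
  then have "real CARD('n) \<le> norm1inf (\<lambda>r. supp_set (F r)) \<theta>"
    unfolding norm1inf_def using sum_mono[of "UNIV :: 'n set" "\<lambda>_. 1 :: real"] by simp
  then show ?thesis unfolding M_def power2_eq_square by (intro mult_left_mono) auto
qed

lemma M_ge_4:
  assumes "CARD('n) \<noteq> 1"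
  shows "4 \<le> M"
proof -
  have "2 \<le> CARD('n)"
    using assms zero_less_card_finite[where 'a = 'n] by linarith
  then have "2\<^sup>2 \<le> (real CARD('n))\<^sup>2" by (intro power_mono) auto
  then show ?thesis using M_ge by simp
qed

lemma dist_Xi_sq_le:
  assumes "y \<in> Bprod F"
  shows "(dist_theta \<theta> y (Xi F))\<^sup>2 \<le> M / 2 * (\<Sum>i\<in>UNIV. (Aop y i - Aop \<xi> i)\<^sup>2)"
proof -
  obtain z where "z \<in> Bprod F" "Aop z = Aop \<xi>"
    "(\<Sum>r\<in>UNIV. \<Sum>i\<in>UNIV. \<theta> r i * (y r i - z r i)\<^sup>2) \<le> M / 2 * (\<Sum>i\<in>UNIV. (Aop y i - Aop \<xi> i)\<^sup>2)"
    unfolding M_def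
    by (rule fibre_point_close[of F \<theta> y \<xi>, OF submodular empty cover theta_nonneg assms \<xi>])
  then show ?thesis
    using dist_theta_sq_le[of \<theta> z "Xi F" y] theta_nonneg by (simp add: Xi_fibre)
qed

lemma pcd_step_Bprod:
  assumes "y \<in> Bprod F"
  shows "pcd_step F \<theta> C y \<in> Bprod F"
  using assms by (auto simp: Bprod_def pcd_step_def intro!: wproj_minimizes(1) theta_nonneg)

text \<open>Since block \<open>r\<close> moves only inside \<open>supp_set (F r)\<close>, at most \<open>mu C i\<close> of the blocks in \<open>C\<close>
  contribute to coordinate \<open>i\<close>; this is the expected separable overapproximation behind
  the choice of \<open>\<theta>\<close>.\<close>

lemma gfun_blocks_le:
  assumes "\<And>r i. i \<notin> supp_set (F r) \<Longrightarrow> h r i = 0"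
  shows "gfun (\<lambda>r i. if r \<in> C then y r i + h r i else y r i)
    \<le> gfun y + (\<Sum>r\<in>UNIV. (\<Sum>i\<in>UNIV. Aop y i * h r i) * of_bool (r \<in> C)
      + (\<Sum>i\<in>UNIV. 1/2 * (h r i)\<^sup>2 * (if r \<in> C then real (mu (\<lambda>r. supp_set (F r)) C i) else 0)))"
proof -
  define k where "k r i = of_bool (r \<in> C) * h r i" for r i
  have "Aop (\<lambda>r i. if r \<in> C then y r i + h r i else y r i) i = (\<Sum>r\<in>UNIV. y r i + k r i)" for i
    unfolding Aop_def by (intro sum.cong) (auto simp: k_def)
  then have eq: "Aop (\<lambda>r i. if r \<in> C then y r i + h r i else y r i) i = Aop y i + 1 * Aop k i" for i
    by (simp add: Aop_def sum.distrib)
  have "(Aop k i)\<^sup>2 \<le> (\<Sum>r\<in>UNIV. (h r i)\<^sup>2 * (if r \<in> C then real (mu (\<lambda>r. supp_set (F r)) C i) else 0))" for i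
  proof -
    let ?C = "{r \<in> C. i \<in> supp_set (F r)}"
    have "Aop k i = (\<Sum>r\<in>?C. h r i)"
      unfolding Aop_def using assms by (intro sum.mono_neutral_cong_right) (auto simp: k_def)
    \<comment> \<open>Cauchy-Schwarz over the drawn blocks incident to \<open>i\<close>, whose
      number is \<open>mu\<close>.\<close>
    then have "(Aop k i)\<^sup>2 \<le> (\<Sum>r\<in>?C. (h r i)\<^sup>2) * real (mu (\<lambda>r. supp_set (F r)) C i)"
      using sum_squared_le_sum_of_squares[of "\<lambda>r. h r i" ?C] by (simp add: mu_def)
    also have "(\<Sum>r\<in>?C. (h r i)\<^sup>2) = (\<Sum>r\<in>UNIV. (h r i)\<^sup>2 * of_bool (r \<in> C))"
      using assms by (intro sum.mono_neutral_cong_left) auto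
    also have "\<dots> * real (mu (\<lambda>r. supp_set (F r)) C i)
        = (\<Sum>r\<in>UNIV. (h r i)\<^sup>2 * (if r \<in> C then real (mu (\<lambda>r. supp_set (F r)) C i) else 0))"
      unfolding sum_distrib_right by (intro sum.cong) auto
    finally show ?thesis .
  qed
  then have "(\<Sum>i\<in>UNIV. (Aop k i)\<^sup>2) \<le> (\<Sum>i\<in>UNIV. \<Sum>r\<in>UNIV. (h r i)\<^sup>2 * (if r \<in> C then real (mu (\<lambda>r. supp_set (F r)) C i) else 0))"
    by (intro sum_mono)
  also have "\<dots> = (\<Sum>r\<in>UNIV. \<Sum>i\<in>UNIV. (h r i)\<^sup>2 * (if r \<in> C then real (mu (\<lambda>r. supp_set (F r)) C i) else 0))"
    by (rule sum.swap)
  finally have quad: "1/2 * (\<Sum>i\<in>UNIV. (Aop k i)\<^sup>2)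
      \<le> (\<Sum>r\<in>UNIV. \<Sum>i\<in>UNIV. 1/2 * (h r i)\<^sup>2 * (if r \<in> C then real (mu (\<lambda>r. supp_set (F r)) C i) else 0))"
    by (simp only: mult.assoc flip: sum_distrib_left)
  have "(\<Sum>i\<in>UNIV. Aop y i * Aop k i) = (\<Sum>r\<in>UNIV. \<Sum>i\<in>UNIV. k r i * Aop y i)"
    unfolding sum_blocks_mult by (simp add: mult.commute)
  also have "\<dots> = (\<Sum>r\<in>UNIV. (\<Sum>i\<in>UNIV. Aop y i * h r i) * of_bool (r \<in> C))"
    unfolding k_def sum_distrib_right by (simp only: mult_ac)
  finally show ?thesis
    using quad gfun_expand[of _ y 1 "Aop k", OF eq] by (simp add: sum.distrib)
qed

text \<open>Every outcome is compared with one point \<open>z\<close> of \<open>Xi F\<close> nearest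
  to \<open>y\<close>, so the change of potential is bounded by a sum over drawn blocks. In
  expectation its quadratic part carries exactly the weights of the projections.\<close>

lemma expected_potential_step:
  assumes y: "y \<in> Bprod F"
  shows "measure_pmf.expectation P (\<lambda>C. potential (pcd_step F \<theta> C y))
    \<le> potential y + \<alpha> * (\<Sum>i\<in>UNIV. Aop y i * (Aop \<xi> i - Aop y i))"
proof -
  have "compact (Xi F)" "Xi F \<noteq> {}"
    using \<xi> by (auto simp: Xi_fibre compact_Bprod_fibre)
  then obtain z where z: "z \<in> Xi F"
    and dist: "(dist_theta \<theta> y (Xi F))\<^sup>2 = (\<Sum>r\<in>UNIV. \<Sum>i\<in>UNIV. \<theta> r i * (y r i - z r i)\<^sup>2)"
    using dist_theta_attained[of \<theta> "Xi F" y] theta_nonneg by blast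
  have zB: "z \<in> Bprod F" and Az: "Aop z = Aop \<xi>" using z by (auto simp: Xi_fibre)
  \<comment> \<open>All blocks use the same \<open>Aop y\<close>, so each update is independent of
    \<open>C\<close>; the draw only selects which updates are kept.\<close>
  define p where "p r = pcd_step F \<theta> UNIV y r" for r
  define h where "h r i = p r i - y r i" for r i
  define Q where "Q r v = (\<Sum>i\<in>UNIV. \<theta> r i * (v i - z r i)\<^sup>2)" for r v
  have pB: "p \<in> Bprod F" unfolding p_def by (rule pcd_step_Bprod[OF y])
  have step: "pcd_step F \<theta> C y = (\<lambda>r. if r \<in> C then p r else y r)" for C
    by (auto simp: pcd_step_def p_def)
  have step_h: "pcd_step F \<theta> C y = (\<lambda>r i. if r \<in> C then y r i + h r i else y r i)" for C
    by (auto simp: step h_def fun_eq_iff)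
  have h0: "h r i = 0" if "i \<notin> supp_set (F r)" for r i
    using Bprod_vanish[OF y that] Bprod_vanish[OF pB that] by (simp add: h_def)
  have "potential (pcd_step F \<theta> C y) \<le> potential y
      + (\<Sum>r\<in>UNIV. ((\<Sum>i\<in>UNIV. Aop y i * h r i) + 1/2 * (Q r (p r) - Q r (y r))) * of_bool (r \<in> C)
      + (\<Sum>i\<in>UNIV. 1/2 * (h r i)\<^sup>2 * (if r \<in> C then real (mu (\<lambda>r. supp_set (F r)) C i) else 0)))" for C
  proof -
    have "(dist_theta \<theta> (pcd_step F \<theta> C y) (Xi F))\<^sup>2 \<le> (\<Sum>r\<in>UNIV. Q r (pcd_step F \<theta> C y r))"
      unfolding Q_def by (rule dist_theta_sq_le[OF theta_nonneg z])
    also have "\<dots> = (\<Sum>r\<in>UNIV. Q r (y r) + (Q r (p r) - Q r (y r)) * of_bool (r \<in> C))"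
      by (intro sum.cong) (auto simp: step)
    finally have "1/2 * (dist_theta \<theta> (pcd_step F \<theta> C y) (Xi F))\<^sup>2
        \<le> 1/2 * (dist_theta \<theta> y (Xi F))\<^sup>2 + (\<Sum>r\<in>UNIV. 1/2 * (Q r (p r) - Q r (y r)) * of_bool (r \<in> C))"
      unfolding dist Q_def[symmetric] sum.distrib mult.assoc sum_distrib_left[symmetric]
      by linarith
    moreover have "gfun (pcd_step F \<theta> C y) \<le> gfun y
        + (\<Sum>r\<in>UNIV. (\<Sum>i\<in>UNIV. Aop y i * h r i) * of_bool (r \<in> C)
        + (\<Sum>i\<in>UNIV. 1/2 * (h r i)\<^sup>2 * (if r \<in> C then real (mu (\<lambda>r. supp_set (F r)) C i) else 0)))"
      unfolding step_h by (rule gfun_blocks_le) (rule h0)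
    ultimately show ?thesis
      unfolding potential_def by (simp only: distrib_right sum.distrib)
  qed
  then have "measure_pmf.expectation P (\<lambda>C. potential (pcd_step F \<theta> C y)) \<le> potential y
      + \<alpha> * (\<Sum>r\<in>UNIV. ((\<Sum>i\<in>UNIV. Aop y i * h r i) + 1/2 * (Q r (p r) - Q r (y r)))
        + (\<Sum>i\<in>UNIV. \<theta> r i * (1/2 * (h r i)\<^sup>2)))"
    unfolding \<theta>_def thetaF_def by (rule alpha_proper_expectation_affine[OF proper])
  also have "\<dots> \<le> potential y + \<alpha> * (\<Sum>r\<in>UNIV. \<Sum>i\<in>UNIV. Aop y i * (z r i - y r i))"
  proof (intro add_left_mono mult_left_mono sum_mono)
    fix r
    have yr: "y r \<in> base_polytope (F r)" and zr: "z r \<in> base_polytope (F r)"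
      using y zB by (auto simp: Bprod_def)
    have "u i = 0" if "u \<in> base_polytope (F r)" "\<theta> r i = 0" for u i
      using base_polytope_vanish[of "F r" u i] empty[of r] that(1) theta_ge_1[of i r] that(2) by fastforce
    then have "\<forall>u\<in>base_polytope (F r). \<forall>i. \<theta> r i = 0 \<longrightarrow> u i = 0" by blast
    \<comment> \<open>The quadratic term from the overapproximation of \<open>gfun\<close> is
      absorbed by the one on the left of the three-point inequality.\<close>
    from wproj_three_point[where F = "F r" and w = "\<theta> r" and c = "Aop y", OF yr theta_nonneg zr this]
    have "(\<Sum>i\<in>UNIV. Aop y i * h r i) + 1/2 * (\<Sum>i\<in>UNIV. \<theta> r i * (h r i)\<^sup>2) + 1/2 * Q r (p r)
        \<le> (\<Sum>i\<in>UNIV. Aop y i * (z r i - y r i)) + 1/2 * Q r (y r)"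
      by (simp add: h_def Q_def p_def pcd_step_def)
    moreover have "(\<Sum>i\<in>UNIV. \<theta> r i * (1/2 * (h r i)\<^sup>2)) = 1/2 * (\<Sum>i\<in>UNIV. \<theta> r i * (h r i)\<^sup>2)"
      by (simp add: sum_distrib_left)
    ultimately show "((\<Sum>i\<in>UNIV. Aop y i * h r i) + 1/2 * (Q r (p r) - Q r (y r)))
        + (\<Sum>i\<in>UNIV. \<theta> r i * (1/2 * (h r i)\<^sup>2)) \<le> (\<Sum>i\<in>UNIV. Aop y i * (z r i - y r i))"
      by (simp add: field_simps)
  qed (use proper in \<open>simp add: alpha_proper_def\<close>)
  also have "(\<Sum>r\<in>UNIV. \<Sum>i\<in>UNIV. Aop y i * (z r i - y r i)) = (\<Sum>i\<in>UNIV. Aop y i * (Aop \<xi> i - Aop y i))"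
    unfolding Az[symmetric] using sum_blocks_mult[of "\<lambda>r i. z r i - y r i" "Aop y"]
    by (simp add: Aop_def sum_subtractf mult.commute)
  finally show ?thesis .
qed

lemma potential_trivial:
  assumes "CARD('n) = 1" "y \<in> Bprod F"
  shows "potential y = 0" and "Aop y = Aop \<xi>"
proof -
  obtain i0 :: 'n where UN: "UNIV = {i0}" using assms(1) by (auto simp: card_1_singleton_iff)
  have const: "y' r i = F r UNIV" if "y' \<in> Bprod F" for y' r i
  proof -
    have "i = i0" using UN by auto
    moreover have "sum (y' r) UNIV = F r UNIV"
      using that by (intro base_polytopeD(2)) (simp add: Bprod_def)
    ultimately show ?thesis unfolding UN by simp
  qed
  then have "y = \<xi>" using const[OF assms(2)] const[OF \<xi>] by (simp add: fun_eq_iff)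
  then show "Aop y = Aop \<xi>" by simp
  have "(dist_theta \<theta> y (Xi F))\<^sup>2 \<le> 0"
    using dist_Xi_sq_le[OF assms(2)] \<open>y = \<xi>\<close> by simp
  then show "potential y = 0"
    using \<open>y = \<xi>\<close> by (simp add: potential_def gstar_gfun)
qed

lemma expected_potential_contraction:
  assumes y: "y \<in> Bprod F" and n: "CARD('n) \<noteq> 1"
  shows "measure_pmf.expectation P (\<lambda>C. potential (pcd_step F \<theta> C y))
    \<le> (1 - 4 * \<alpha> / (M + 2)) * potential y"
proof -
  define a where "a = gfun y - gfun \<xi>"
  define b where "b = 1/2 * (\<Sum>i\<in>UNIV. (Aop y i - Aop \<xi> i)\<^sup>2)"
  note M = M_ge_4[OF n]
  have ab: "b \<le> a" unfolding a_def b_def by (rule gfun_minimizer_gap[OF \<xi> \<xi>_min y])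
  have D: "1/2 * (dist_theta \<theta> y (Xi F))\<^sup>2 \<le> M / 2 * b"
    using dist_Xi_sq_le[OF y] by (simp add: b_def)
  \<comment> \<open>The exact expansion of \<open>gfun \<xi>\<close> around
    \<open>y\<close>.\<close>
  have "(\<Sum>i\<in>UNIV. Aop y i * (Aop \<xi> i - Aop y i)) = - (a + b)"
    using gfun_expand[of \<xi> y 1 "\<lambda>i. Aop \<xi> i - Aop y i"] by (simp add: a_def b_def power2_commute)
  then have step: "measure_pmf.expectation P (\<lambda>C. potential (pcd_step F \<theta> C y))
      \<le> potential y - \<alpha> * (a + b)"
    using expected_potential_step[OF y] by (simp only: mult_minus_right add_uminus_conv_diff)
  \<comment> \<open>This product is exactly
    \<open>(a + b) * (M + 2) - 4 * (a + M / 2 * b)\<close>.\<close>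
  have "0 \<le> (a - b) * (M - 2)" using ab M by simp
  then have "4 * (a + M / 2 * b) \<le> (a + b) * (M + 2)" by (simp add: algebra_simps)
  moreover have "potential y \<le> a + M / 2 * b"
    using D by (simp add: potential_def gstar_gfun a_def)
  then have "4 * potential y \<le> 4 * (a + M / 2 * b)" by (rule mult_left_mono) simp
  ultimately have "4 * potential y \<le> (a + b) * (M + 2)" by (rule order_trans[rotated])
  then have "4 * potential y / (M + 2) \<le> a + b" using M by (simp add: pos_divide_le_eq)
  then have "\<alpha> * (4 * potential y / (M + 2)) \<le> \<alpha> * (a + b)"
    using proper by (intro mult_left_mono) (auto simp: alpha_proper_def)
  with step show ?thesis by (simp add: algebra_simps)
qed

text \<open>Finite support turns the expectation over an iterate into a finite sum.\<close>

lemma pcd_iter_support: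
  assumes "y0 \<in> Bprod F"
  shows "set_pmf (pcd_iter F \<theta> P y0 k) \<subseteq> Bprod F" and "finite (set_pmf (pcd_iter F \<theta> P y0 k))"
  using assms by (induction k) (auto simp: pcd_step_Bprod)

lemma expected_potential_iter:
  assumes y0: "y0 \<in> Bprod F"
  shows "measure_pmf.expectation (pcd_iter F \<theta> P y0 k) potential
    \<le> (1 - 4 * \<alpha> / (M + 2)) ^ k * potential y0"
proof (cases "CARD('n) = 1")
  case True
  \<comment> \<open>For \<open>CARD('n) = 1\<close> the claimed factor can be negative; the
    potential vanishes at every iterate instead.\<close>
  have "measure_pmf.expectation (pcd_iter F \<theta> P y0 k) potential = 0"
    using potential_trivial(1)[OF True] pcd_iter_support(1)[OF y0, of k]
    by (intro integral_eq_zero_AE) (auto simp: AE_measure_pmf_iff)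
  then show ?thesis by (simp add: potential_trivial(1)[OF True y0])
next
  case False
  note M = M_ge_4[OF False]
  let ?\<rho> = "1 - 4 * \<alpha> / (M + 2)"
  \<comment> \<open>Nonnegativity of the factor allows the induction hypothesis to be multiplied by
    it.\<close>
  have "4 * \<alpha> \<le> M + 2" using M proper by (simp add: alpha_proper_def)
  then have \<rho>: "0 \<le> ?\<rho>" using M by (simp add: field_simps)
  show ?thesis
  proof (induction k)
    case (Suc k)
    let ?p = "pcd_iter F \<theta> P y0 k"
    \<comment> \<open>Condition on the iterate \<open>k\<close> and apply the one-step contraction
      to each of its values.\<close>
    have "measure_pmf.expectation (pcd_iter F \<theta> P y0 (Suc k)) potential
        = (\<Sum>y\<in>set_pmf ?p. pmf ?p y * measure_pmf.expectation P (\<lambda>C. potential (pcd_step F \<theta> C y)))"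
      using pcd_iter_support(2)[OF y0, of k] by (simp add: pmf_expectation_bind[of "set_pmf ?p"])
    also have "\<dots> \<le> (\<Sum>y\<in>set_pmf ?p. pmf ?p y * (?\<rho> * potential y))"
      using pcd_iter_support(1)[OF y0, of k] False
      by (intro sum_mono mult_left_mono expected_potential_contraction) auto
    also have "\<dots> = ?\<rho> * measure_pmf.expectation ?p potential"
      using pcd_iter_support(2)[OF y0, of k]
      by (subst integral_measure_pmf_real[of "set_pmf ?p"]) (auto simp: sum_distrib_left mult_ac)
    also have "\<dots> \<le> ?\<rho> * (?\<rho> ^ k * potential y0)"
      using Suc.IH \<rho> by (rule mult_left_mono)
    finally show ?case by simp
  qed simp
qed

end

theorem theorem3p10:
  fixes F :: "'r::finite \<Rightarrow> 'n::finite set \<Rightarrow> real"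
    and P :: "'r set pmf" and \<alpha> :: real and y0 :: "'r \<Rightarrow> 'n \<Rightarrow> real"
  assumes "\<forall>r. submodular (F r)"
    and "\<forall>r. F r {} = 0"
    and "\<forall>i. \<exists>r. i \<in> supp_set (F r)"
    and "alpha_proper P \<alpha>"
    and "y0 \<in> Bprod F"
  shows "\<forall>k. measure_pmf.expectation (pcd_iter F (thetaF F P) P y0 k)
              (\<lambda>y. gfun y - gstar F + 1/2 * (dist_theta (thetaF F P) y (Xi F))\<^sup>2)
           \<le> (1 - 4 * \<alpha> / (real CARD('n) * norm1inf (\<lambda>r. supp_set (F r)) (thetaF F P) + 2)) ^ k
              * (gfun y0 - gstar F + 1/2 * (dist_theta (thetaF F P) y0 (Xi F))\<^sup>2)"
proof -
  obtain \<xi> where "\<xi> \<in> Bprod F" "\<And>y. y \<in> Bprod F \<Longrightarrow> gfun \<xi> \<le> gfun y"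
    using gfun_minimizer_exists assms(5) by blast
  then interpret coordinate_descent F P \<alpha> \<xi>
    using assms by unfold_locales auto
  show ?thesis
    using expected_potential_iter[OF assms(5)]
    unfolding potential_def[abs_def] \<theta>_def M_def by blast
qed

end
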